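(* Let $1<p<\infty$, $\lambda\ge0$, and let $\mathcal{E}:\mathfrak{M}\to(-\infty,+\infty]$ be a proper, lower semicontinuous, $\lambda$-geodesically convex functional on a (complete) length space $(\mathfrak{M},d)$. Suppose that for all $v_0\in D(\mathcal{E})$ there is a $p$-gradient flow $v$ of $\mathcal{E}$ (with respect to the strong upper gradient $|D^-\mathcal{E}|$) with $v(0+)=v_0$, and that for $\varphi\in\mathfrak{M}$ with $|D^-\mathcal{E}|(\varphi)=0$ one has $\{\mathcal{E}(\cdot|\varphi)>0\}\subseteq\{|D^-\mathcal{E}|>0\}$. Then, for $\alpha\in(0,1]$, the following statements hold. (1) If there is $c>0$ such that $$(\mathcal{E}(v|\varphi))^{1-\alpha}\le c\,|D^-\mathcal{E}|(v)\qquad\text{for all } v\in D(\mathcal{E}),$$ then $$\inf_{\tilde\varphi\in\operatorname{argmin}(\mathcal{E})}d(v,\tilde\varphi)\le\frac{c}{\alpha}(\mathcal{E}(v|\varphi))^{\alpha}\qquad\text{for all } v\in D(\mathcal{E}).$$ (2) If there is $c>0$ such that $\inf_{\tilde\varphi\in\operatorname{argmin}(\mathcal{E})}d(v,\tilde\varphi)\le\frac{c}{\alpha}(\mathcal{E}(v|\varphi))^{\alpha}$ for all $v\in D(\mathcal{E})$, then $$(\mathcal{E}(v|\varphi))^{1-\alpha}\le\frac{c}{\alpha}\,|D^-\mathcal{E}|(v)\qquad\text{for all } v\in D(\mathcal{E}).$$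
   Context: $p'=p/(p-1)$; $D(\mathcal{E})=\{\mathcal{E}<+\infty\}$; proper means $D(\mathcal{E})\ne\emptyset$; $\mathcal{E}(v|\varphi):=\mathcal{E}(v)-\mathcal{E}(\varphi)$; $\operatorname{argmin}(\mathcal{E})$ is the set of global minimizers; $v(0+):=\lim_{t\downarrow0}v(t)$ in $\mathfrak{M}$. Length space: any two points $v_0,v_1$ are joined by a constant speed geodesic, i.e. $\gamma:[0,1]\to\mathfrak{M}$ with $\gamma(0)=v_0$, $\gamma(1)=v_1$ and $d(\gamma(s),\gamma(t))=(t-s)d(v_0,v_1)$ for $s\le t$. $\mathcal{E}$ is $\lambda$-geodesically convex if for all $v_0,v_1\in D(\mathcal{E})$ there is such a $\gamma$ with $\mathcal{E}(\gamma(t))\le(1-t)\mathcal{E}(v_0)+t\mathcal{E}(v_1)-\frac\lambda2t(1-t)d^2(v_0,v_1)$ for all $t\in[0,1]$. Descending slope: $|D^-\mathcal{E}|(u)=\limsup_{v\to u}\frac{[\mathcal{E}(v)-\mathcal{E}(u)]^-}{d(v,u)}$ for $u\in D(\mathcal{E})$ and $+\infty$ otherwise. For such $\mathcal{E}$ it is a strong upper gradient of $\mathcal{E}$: $|\mathcal{E}(v(t))-\mathcal{E}(v(s))|\le\int_s^t|D^-\mathcal{E}|(v(r))|v'|(r)\,dr$ along absolutely continuous curves, where $|v'|(t)=\lim_{s\to t}d(v(s),v(t))/|s-t|$. $v:[0,\infty)\to\mathfrak{M}$ is a $p$-gradient flow if it is locally absolutely continuous on $(0,\infty)$, $\mathcal{E}\circ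 v:(0,\infty)\to\mathbb{R}$ is non-increasing and $\frac{d}{dt}\mathcal{E}(v(t))\le-\frac1{p'}|D^-\mathcal{E}|^{p'}(v(t))-\frac1p|v'|^p(t)$ for a.e. $t>0$.
   Formalization: For α = 1 the power 0^0 is read as 0, so that (E(v|φ))^{1-α} vanishes where E(v|φ) = 0; with 0^0 = 1 the hypothesis of (1) could never hold and the conclusion of (2) would fail at v = φ. *)

theory Defs
  imports "HOL-Analysis.Analysis"
begin

definition dom_energy :: "('a \<Rightarrow> ereal) \<Rightarrow> 'a set"
  where "dom_energy E = {v. E v < \<infinity>}"

definition proper_energy :: "('a \<Rightarrow> ereal) \<Rightarrow> bool"
  where "proper_energy E \<longleftrightarrow> dom_energy E \<noteq> {}"

definition rel_energy :: "('a \<Rightarrow> ereal) \<Rightarrow> 'a \<Rightarrow> 'a \<Rightarrow> ereal"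
  where "rel_energy E v \<phi> = E v - E \<phi>"

definition argmin_energy :: "('a \<Rightarrow> ereal) \<Rightarrow> 'a set"
  where "argmin_energy E = {v. is_arg_min E (\<lambda>_. True) v}"

(* Real powers on [0, \<infinity>], meant for a \<ge> 0 and x \<ge> 0, with \<infinity> to the power a equal to \<infinity>.
   As for powr, 0 to the power a is 0 for every a, including a = 0.  The convention for a = 0
   matters for inequalities such as rel_energy E v \<phi> to the power 1 - \<alpha> \<le> c * slope at v:
   with \<alpha> = 1 and 0 to the power 0 equal to 1 it would fail at every minimizer v. *)
definition epowr :: "ereal \<Rightarrow> real \<Rightarrow> ereal"
  where "epowr x a = (if x = \<infinity> then \<infinity> else ereal (real_of_ereal x powr a))"

definition lower_semicont :: "('a::topological_space \<Rightarrow> ereal) \<Rightarrow> bool"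
  where "lower_semicont E \<longleftrightarrow> (\<forall>u. E u \<le> Liminf (at u) E)"

definition const_speed_geodesic :: "(real \<Rightarrow> 'a::metric_space) \<Rightarrow> 'a \<Rightarrow> 'a \<Rightarrow> bool"
  where "const_speed_geodesic \<gamma> v0 v1 \<longleftrightarrow>
    \<gamma> 0 = v0 \<and> \<gamma> 1 = v1 \<and>
    (\<forall>s t. 0 \<le> s \<and> s \<le> t \<and> t \<le> 1 \<longrightarrow> dist (\<gamma> s) (\<gamma> t) = (t - s) * dist v0 v1)"

definition length_space :: "'a::metric_space itself \<Rightarrow> bool"
  where "length_space _ \<longleftrightarrow> (\<forall>v0 v1 :: 'a. \<exists>\<gamma>. const_speed_geodesic \<gamma> v0 v1)"

definition geodesically_convex :: "real \<Rightarrow> ('a::metric_space \<Rightarrow> ereal) \<Rightarrow> bool"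
  where "geodesically_convex lam E \<longleftrightarrow>
    (\<forall>v0 \<in> dom_energy E. \<forall>v1 \<in> dom_energy E. \<exists>\<gamma>. const_speed_geodesic \<gamma> v0 v1 \<and>
      (\<forall>t \<in> {0..1}. E (\<gamma> t) \<le> ereal (1 - t) * E v0 + ereal t * E v1
                             - ereal (lam / 2 * t * (1 - t) * (dist v0 v1)\<^sup>2)))"

(* The inner max is the negative part of E v - E u; the outer max only matters at an isolated
   point u, where the limsup over the trivial filter would be -\<infinity> instead of 0. *)
definition descending_slope :: "('a::metric_space \<Rightarrow> ereal) \<Rightarrow> 'a \<Rightarrow> ereal"
  where "descending_slope E u =
    (if u \<in> dom_energy E
     then max 0 (Limsup (at u) (\<lambda>v. max 0 (- (E v - E u)) / ereal (dist v u)))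
     else \<infinity>)"

(* Curves on an interval are total functions on the reals, whose values outside the interval
   are irrelevant.  Local absolute continuity on (0, \<infinity>) is the usual metric notion: the
   increments are controlled by the integral of a locally integrable function. *)
definition loc_abs_continuous :: "(real \<Rightarrow> 'a::metric_space) \<Rightarrow> bool"
  where "loc_abs_continuous v \<longleftrightarrow>
    (\<exists>m :: real \<Rightarrow> real.
      (\<forall>s t. 0 < s \<and> s \<le> t \<longrightarrow>
        set_integrable lborel {s..t} m \<and>
        dist (v s) (v t) \<le> (LINT r:{s..t}|lborel. m r)))"

definition has_metric_derivative :: "(real \<Rightarrow> 'a::metric_space) \<Rightarrow> real \<Rightarrow> real \<Rightarrow> bool"
  where "has_metric_derivative v m t \<longleftrightarrow>
    ((\<lambda>s. dist (v s) (v t) / \<bar>s - t\<bar>) \<longlongrightarrow> m) (at t)"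

(* Both derivatives exist almost everywhere, as the energy is monotone and the curve locally
   absolutely continuous along v; so asserting their existence inside the almost-everywhere
   quantifier adds nothing to the dissipation inequality. *)
definition p_gradient_flow :: "real \<Rightarrow> ('a::metric_space \<Rightarrow> ereal) \<Rightarrow> (real \<Rightarrow> 'a) \<Rightarrow> bool"
  where "p_gradient_flow p E v \<longleftrightarrow>
    (let p' = p / (p - 1) in
      loc_abs_continuous v \<and>
      (\<forall>t > 0. \<bar>E (v t)\<bar> \<noteq> \<infinity>) \<and>
      antimono_on {0<..} (\<lambda>t. E (v t)) \<and>
      (AE t in lborel. 0 < t \<longrightarrow>
        (\<exists>D m. ((\<lambda>s. real_of_ereal (E (v s))) has_real_derivative D) (at t) \<and>
               has_metric_derivative v m t \<and>
               ereal D \<le> - (ereal (1 / p') * epowr (descending_slope E (v t)) p')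
                          - ereal (1 / p * m powr p))))"

end

theory Submission
  imports Defs
begin

text \<open>
  Convexity gives $E(v) - E(w) \le |D^-E|(v)\, d(v, w)$ for all $v, w$ of finite energy. Hence
  \<open>\<phi>\<close> is a global minimizer, and (2) follows by letting \<open>w\<close> range over the minimizers.

  For (1), put $g = \frac{c}{\alpha} (E - E(\varphi))^\alpha$ and $k < 1$.
  Ekeland's variational principle yields a point \<open>y\<close> with $g(y) + k\, d(v, y) \le g(v)$ and
  $g(z) + k\, d(y, z) > g(y)$ for all $z \ne y$. If \<open>y\<close> were not a minimizer, then by the
  hypothesis on the slope some $z \ne y$ would satisfy
  $c\,(E(y) - E(z)) > k\, (E(y) - E(\varphi))^{1-\alpha} d(y, z)$, and concavity of
  $x \mapsto x^\alpha$ turns this into $g(y) - g(z) \ge k\, d(y, z)$, a contradiction. So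
  \<open>y\<close> is a minimizer with $k\, d(v, y) \le g(v)$; finally $k \to 1$.
\<close>

section \<open>Ekeland's principle in complete metric spaces\<close>

text \<open>Nearly optimal choices in the sets \<open>S x\<close> produce a nested sequence of
  closed sets with diameters tending to 0; completeness leaves exactly one common point, the desired
  \<open>y\<close>. The set \<open>D\<close> acts as the effective domain of an extended-valued
  functional, so lower semicontinuity appears as closedness, in the whole space, of the sublevel
  sets within \<open>D\<close>.\<close>

theorem ekeland_variational_principle:
  fixes g :: "'a::complete_space \<Rightarrow> real"
  assumes closed_sublevel: "\<And>a. closed {y \<in> D. g y \<le> a}"
    and bounded_below: "\<And>y. y \<in> D \<Longrightarrow> m \<le> g y"
    and "x \<in> D" and "0 < k"
  obtains y where "y \<in> D" "g y + k * dist x y \<le> g x"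
    "\<And>z. z \<in> D \<Longrightarrow> z \<noteq> y \<Longrightarrow> g y < g z + k * dist y z"
proof -
  \<comment> \<open>Membership in \<open>S\<close> is the Bishop-Phelps order on \<open>D\<close>,
    transitive by the triangle inequality; the goal is a point \<open>y\<close> with nothing else in
    \<open>S y\<close>.\<close>
  define S where "S x = {y \<in> D. g y + k * dist x y \<le> g x}" for x
  have S_refl: "x \<in> S x" if "x \<in> D" for x
    using that by (simp add: S_def)
  have S_trans: "S y \<subseteq> S x" if "y \<in> S x" for x y
  proof
    fix z assume "z \<in> S y"
    moreover have "k * dist x z \<le> k * dist x y + k * dist y z"
      using \<open>0 < k\<close> by (metis dist_triangle distrib_left mult_le_cancel_left_pos)
    ultimately show "z \<in> S x"
      using that by (auto simp: S_def)
  qed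
  have S_closed: "closed (S x)" for x
    unfolding closed_sequential_limits
  proof (intro allI impI)
    fix s l assume s: "(\<forall>n. s n \<in> S x) \<and> s \<longlonglongrightarrow> l"
    \<comment> \<open>The bound on \<open>g (s n)\<close> varies with \<open>n\<close>, while a
      closed sublevel set has a fixed level. The slack \<open>e\<close> gives a level that
      eventually dominates all these bounds, and is removed afterwards.\<close>
    have sublevel: "l \<in> D \<and> g l \<le> g x - k * dist x l + e" if "0 < e" for e
    proof -
      have "(\<lambda>n. g x - k * dist x (s n)) \<longlonglongrightarrow> g x - k * dist x l"
        using s by (intro tendsto_intros) auto
      then have "\<forall>\<^sub>F n in sequentially. g x - k * dist x (s n) < g x - k * dist x l + e"
        by (rule order_tendstoD) (use that in simp)
      then have "\<forall>\<^sub>F n in sequentially. s n \<in> {y \<in> D. g y \<le> g x - k * dist x l + e}"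
      proof eventually_elim
        case (elim n)
        moreover have "s n \<in> S x" using s by blast
        ultimately show ?case by (auto simp: S_def)
      qed
      then have "l \<in> {y \<in> D. g y \<le> g x - k * dist x l + e}"
        by (rule Lim_in_closed_set[OF closed_sublevel]) (use s in auto)
      then show ?thesis by simp
    qed
    then have "g l \<le> g x - k * dist x l"
      by (meson field_le_epsilon)
    then show "l \<in> S x"
      using sublevel[of 1] by (simp add: S_def)
  qed
  have next_point: "\<exists>y. y \<in> S x \<and> (\<forall>z \<in> S x. g y \<le> g z + e)" if "x \<in> D" "0 < e" for x e
  proof -
    have bdd: "bdd_below (g ` S x)"
      using bounded_below by (auto simp: S_def bdd_below_def)
    have "Inf (g ` S x) < Inf (g ` S x) + e" using that by simp
    then obtain y where "y \<in> S x" "g y < Inf (g ` S x) + e"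
      using cInf_lessD[of "g ` S x"] S_refl[OF \<open>x \<in> D\<close>] by blast
    then show ?thesis
      using cInf_lower[OF _ bdd] by (intro exI[of _ y]) fastforce
  qed
  \<comment> \<open>The clause for \<open>n = 0\<close> pins the start of the sequence to
    \<open>x\<close>, so that the common point lies in \<open>S x\<close>. The slack at stage
    \<open>n\<close> tends to 0.\<close>
  have "\<exists>X. \<forall>n. (X n \<in> D \<and> (n = 0 \<longrightarrow> X n = x)) \<and>
      X (Suc n) \<in> S (X n) \<and> (\<forall>z \<in> S (X n). g (X (Suc n)) \<le> g z + inverse (Suc n))"
  proof (rule dependent_nat_choice[where P = "\<lambda>n u. u \<in> D \<and> (n = 0 \<longrightarrow> u = x)"
        and Q = "\<lambda>n u y. y \<in> S u \<and> (\<forall>z \<in> S u. g y \<le> g z + inverse (Suc n))"])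
    show "\<exists>u. u \<in> D \<and> (0 = (0::nat) \<longrightarrow> u = x)" using \<open>x \<in> D\<close> by simp
  next
    fix u n assume "u \<in> D \<and> (n = (0::nat) \<longrightarrow> u = x)"
    then show "\<exists>y. (y \<in> D \<and> (Suc n = 0 \<longrightarrow> y = x)) \<and>
        y \<in> S u \<and> (\<forall>z \<in> S u. g y \<le> g z + inverse (Suc n))"
      using next_point[of u "inverse (Suc n)"] by (auto simp: S_def)
  qed
  then obtain X where X0: "X 0 = x" and XS: "\<And>n. X (Suc n) \<in> S (X n)" and XD: "\<And>n. X n \<in> D"
    and Xinf: "\<And>n z. z \<in> S (X n) \<Longrightarrow> g (X (Suc n)) \<le> g z + inverse (Suc n)"
    by blast
  have nested: "S (X n) \<subseteq> S (X m)" if "m \<le> n" for m n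
    using S_trans[OF XS] that by (rule lift_Suc_antimono_le)
  \<comment> \<open>Membership in \<open>S (X (Suc n))\<close> bounds the distance term by
    \<open>g (X (Suc n)) - g z\<close>; as \<open>z\<close> also lies in \<open>S (X n)\<close>,
    near-optimality bounds this by the slack.\<close>
  have small: "k * dist (X (Suc n)) z \<le> inverse (Suc n)" if "z \<in> S (X (Suc n))" for n z
    using Xinf[of z n] that nested[of n "Suc n"] by (force simp: S_def)
  have "\<exists>n. \<forall>y\<in>S (X n). \<forall>z\<in>S (X n). dist y z < e" if "0 < e" for e
  proof -
    obtain n where n: "inverse (Suc n) < k * e / 2"
      using reals_Archimedean[of "k * e / 2"] \<open>0 < k\<close> \<open>0 < e\<close> by auto
    have half: "dist (X (Suc n)) z < e / 2" if "z \<in> S (X (Suc n))" for z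
    proof -
      have "k * dist (X (Suc n)) z < k * (e / 2)"
        using small[OF that] n by simp
      then show ?thesis using \<open>0 < k\<close> by (simp only: mult_less_cancel_left_pos)
    qed
    show ?thesis
      by (intro exI[of _ "Suc n"] ballI) (metis half dist_commute dist_triangle_half_l)
  qed
  then obtain y where y: "(\<Inter>n. S (X n)) = {y}"
    using decreasing_closed_nest_sing[of "\<lambda>n. S (X n)"] S_closed S_refl[OF XD] nested
    by (metis empty_iff full_SetCompr_eq)
  then have yS: "y \<in> S (X n)" for n by blast
  show thesis
  proof
    show "y \<in> D" "g y + k * dist x y \<le> g x"
      using yS[of 0] by (auto simp: S_def X0)
    \<comment> \<open>By transitivity any point of \<open>S y\<close> lies in every
      \<open>S (X n)\<close>, hence in the intersection, and so equals \<open>y\<close>.\<close>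
    fix z assume "z \<in> D" "z \<noteq> y"
    then have "z \<notin> S y"
      using S_trans[OF yS] y by blast
    then show "g y < g z + k * dist y z"
      using \<open>z \<in> D\<close> by (simp add: S_def)
  qed
qed

section \<open>Lower semicontinuity and the descending slope\<close>

lemma closed_sublevel_of_lower_semicont:
  assumes "lower_semicont E"
  shows "closed {u. E u \<le> r}"
proof -
  have "open {u. r < E u}"
    unfolding open_subopen[of "{u. r < E u}"]
  proof (intro ballI)
    fix u assume "u \<in> {u. r < E u}"
    then have ru: "r < E u" by simp
    also have "E u \<le> Liminf (at u) E"
      using assms by (simp add: lower_semicont_def)
    finally have "\<forall>\<^sub>F v in at u. r < E v" by (rule less_LiminfD)
    \<comment> \<open>The filter \<open>at u\<close> leaves out \<open>u\<close> itself;
      \<open>ru\<close> supplies that point.\<close>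
    with ru have "\<forall>\<^sub>F v in nhds u. r < E v"
      unfolding eventually_at_filter by (auto elim: eventually_mono)
    then show "\<exists>T. open T \<and> u \<in> T \<and> T \<subseteq> {u. r < E u}"
      unfolding eventually_nhds by blast
  qed
  moreover have "- {u. r < E u} = {u. E u \<le> r}" by auto
  ultimately show ?thesis by (metis closed_def double_complement)
qed

text \<open>A limsup above \<open>L\<close> forces some difference quotient above \<open>L\<close>;
  nearness of the point to \<open>u\<close> is not recorded. The sign of \<open>L\<close> takes care
  of both truncations by \<open>max 0\<close>.\<close>

lemma less_descending_slopeD:
  fixes E :: "'a::metric_space \<Rightarrow> ereal"
  assumes "u \<in> dom_energy E" and not_minf: "\<forall>v. E v \<noteq> -\<infinity>"
    and "0 \<le> L" and "ereal L < descending_slope E u"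
  obtains z where "z \<in> dom_energy E" "z \<noteq> u"
    "L * dist z u < real_of_ereal (E u) - real_of_ereal (E z)"
proof -
  let ?q = "\<lambda>v. max 0 (- (E v - E u)) / ereal (dist v u)"
  have "ereal L < Limsup (at u) ?q"
    using assms by (auto simp: descending_slope_def less_max_iff_disj zero_ereal_def)
  have "\<exists>z. z \<noteq> u \<and> ereal L < ?q z"
  proof (rule ccontr)
    assume "\<nexists>z. z \<noteq> u \<and> ereal L < ?q z"
    then have "\<forall>\<^sub>F v in at u. ?q v \<le> ereal L"
      unfolding eventually_at_filter by (intro always_eventually) (meson not_less)
    then have "Limsup (at u) ?q \<le> ereal L" by (rule Limsup_bounded)
    with \<open>ereal L < Limsup (at u) ?q\<close> show False by simp
  qed
  then obtain z where "ereal L < ?q z" "z \<noteq> u" by blast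
  moreover obtain a where a: "E u = ereal a"
    using assms not_minf[rule_format, of u] by (cases "E u") (auto simp: dom_energy_def)
  \<comment> \<open>If \<open>E z\<close> were infinite, the truncated quotient would be 0, which is
    not above \<open>L\<close>.\<close>
  ultimately obtain b where b: "E z = ereal b"
    using \<open>0 \<le> L\<close> not_minf[rule_format, of z] by (cases "E z") (auto simp: max_def)
  have d: "0 < dist z u" using \<open>z \<noteq> u\<close> by simp
  have "L < max 0 (a - b) / dist z u"
    using \<open>ereal L < ?q z\<close> d unfolding a b by (simp add: max_def zero_ereal_def split: if_splits)
  then have "L * dist z u < a - b"
    using d mult_nonneg_nonneg[OF \<open>0 \<le> L\<close>, of "dist z u"]
    by (auto simp: field_simps max_def split: if_splits)
  then show thesis
    using that[of z] \<open>z \<noteq> u\<close> by (simp add: a b dom_energy_def)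
qed

section \<open>Slope estimate from geodesic convexity\<close>

lemma const_speed_geodesic_dist_start:
  assumes "const_speed_geodesic \<gamma> u w" and "0 \<le> t" "t \<le> 1"
  shows "dist (\<gamma> t) u = t * dist u w"
proof -
  have start: "\<gamma> 0 = u" and
    dist: "\<forall>s t. 0 \<le> s \<and> s \<le> t \<and> t \<le> 1 \<longrightarrow> dist (\<gamma> s) (\<gamma> t) = (t - s) * dist u w"
    using assms(1) unfolding const_speed_geodesic_def by blast+
  show ?thesis
    using dist[rule_format, of 0 t] assms(2,3) by (simp add: start dist_commute)
qed

text \<open>Transfers eventual statements near \<open>u\<close> to small times along the geodesic.
  The filter \<open>at u\<close> is punctured, so the curve must leave \<open>u\<close> at once,
  which holds because its speed \<open>dist u w\<close> is positive.\<close>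

lemma const_speed_geodesic_filterlim:
  assumes \<gamma>: "const_speed_geodesic \<gamma> u w" and "u \<noteq> w"
  shows "filterlim \<gamma> (at u) (at_right 0)"
proof -
  note dist_\<gamma> = const_speed_geodesic_dist_start[OF \<gamma>]
  have near: "\<forall>\<^sub>F t in at_right (0::real). 0 < t \<and> t < 1"
    unfolding eventually_at_right_field by (intro exI[of _ 1]) auto
  have "((\<lambda>t. t * dist u w) \<longlongrightarrow> 0 * dist u w) (at_right 0)" by (intro tendsto_intros)
  then have "((\<lambda>t. dist (\<gamma> t) u) \<longlongrightarrow> 0) (at_right 0)"
    unfolding mult_zero_left
    by (rule Lim_transform_eventually) (use near in eventually_elim, simp add: dist_\<gamma>)
  then have "(\<gamma> \<longlongrightarrow> u) (at_right 0)" by (simp only: tendsto_dist_iff[of \<gamma>])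
  moreover have "\<forall>\<^sub>F t in at_right 0. \<gamma> t \<noteq> u"
    using near
  proof eventually_elim
    case (elim t)
    then have "0 < dist (\<gamma> t) u" using \<open>u \<noteq> w\<close> by (simp add: dist_\<gamma>)
    then show ?case by auto
  qed
  ultimately show ?thesis by (simp add: filterlim_at)
qed

text \<open>Along a geodesic from \<open>u\<close> to \<open>w\<close>, convexity makes the energy
  drop by at least \<open>t * (E u - E w)\<close> over the distance \<open>t * dist u w\<close>. The
  quotients are thus at least \<open>L\<close> arbitrarily close to \<open>u\<close>, and so is
  their limsup.\<close>

lemma energy_diff_le_descending_slope:
  fixes E :: "'a::metric_space \<Rightarrow> ereal"
  assumes conv: "geodesically_convex lam E" and "0 \<le> lam" and not_minf: "\<forall>v. E v \<noteq> -\<infinity>"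
    and u: "u \<in> dom_energy E" and w: "w \<in> dom_energy E"
  shows "E u - E w \<le> descending_slope E u * ereal (dist u w)"
proof (cases "E u \<le> E w")
  case True
  then have "E u - E w \<le> 0" using w not_minf[rule_format, of w]
    by (cases "E u"; cases "E w") (auto simp: dom_energy_def)
  moreover have "0 \<le> descending_slope E u" by (auto simp: descending_slope_def)
  ultimately show ?thesis by (meson ereal_0_le_mult ereal_less_eq(5) order_trans zero_le_dist)
next
  case False
  then have "u \<noteq> w" by auto
  obtain a b where a: "E u = ereal a" and b: "E w = ereal b"
    using u w not_minf[rule_format, of u] not_minf[rule_format, of w]
    by (cases "E u"; cases "E w") (auto simp: dom_energy_def)
  have "b < a" using False by (simp add: a b)
  let ?q = "\<lambda>v. max 0 (- (E v - E u)) / ereal (dist v u)"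
  define L where "L = (a - b) / dist u w"
  obtain \<gamma> where \<gamma>: "const_speed_geodesic \<gamma> u w"
    and E\<gamma>: "\<And>t. t \<in> {0..1} \<Longrightarrow> E (\<gamma> t) \<le> ereal (1 - t) * E u + ereal t * E w
                             - ereal (lam / 2 * t * (1 - t) * (dist u w)\<^sup>2)"
    using conv u w unfolding geodesically_convex_def by blast
  have quot: "ereal L \<le> ?q (\<gamma> t)" if t: "0 < t" "t < 1" for t
  proof -
    have d: "dist (\<gamma> t) u = t * dist u w"
      using const_speed_geodesic_dist_start[OF \<gamma>] t by simp
    have le: "E (\<gamma> t) \<le> ereal ((1 - t) * a + t * b - lam / 2 * t * (1 - t) * (dist u w)\<^sup>2)"
      using E\<gamma>[of t] t by (simp add: a b)
    then obtain e where e: "E (\<gamma> t) = ereal e"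
      using not_minf[rule_format, of "\<gamma> t"] by (cases "E (\<gamma> t)") auto
    \<comment> \<open>The sign of \<open>lam\<close> allows the quadratic term to be dropped,
      leaving plain convexity.\<close>
    have "0 \<le> lam / 2 * t * (1 - t) * (dist u w)\<^sup>2"
      using t \<open>0 \<le> lam\<close> by simp
    then have "e \<le> (1 - t) * a + t * b"
      using le by (simp add: e)
    then have "t * (a - b) \<le> a - e" by (simp add: algebra_simps)
    then have "L \<le> (a - e) / (t * dist u w)"
      using divide_right_mono[of "t * (a - b)" "a - e" "t * dist u w"] t by (simp add: L_def)
    moreover have "0 < a - e"
      using \<open>t * (a - b) \<le> a - e\<close> \<open>b < a\<close> t by (smt (verit) mult_pos_pos)
    ultimately show ?thesis
      using t \<open>u \<noteq> w\<close> by (simp add: a e d max_def)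
  qed
  have "ereal L \<le> Limsup (at u) ?q"
  proof (rule ccontr)
    assume "\<not> ereal L \<le> Limsup (at u) ?q"
    then have "\<forall>\<^sub>F v in at u. ?q v < ereal L"
      by (intro Limsup_lessD) simp
    then have "\<forall>\<^sub>F t in at_right 0. ?q (\<gamma> t) < ereal L"
      using const_speed_geodesic_filterlim[OF \<gamma> \<open>u \<noteq> w\<close>] by (rule eventually_compose_filterlim)
    moreover have "\<forall>\<^sub>F t in at_right (0::real). 0 < t \<and> t < 1"
      unfolding eventually_at_right_field by (intro exI[of _ 1]) auto
    ultimately have "\<forall>\<^sub>F t in at_right (0::real). False"
      by eventually_elim (use quot in \<open>auto simp: not_less[symmetric]\<close>)
    then show False by simp
  qed
  then have "ereal L \<le> descending_slope E u"
    using u by (simp add: descending_slope_def le_max_iff_disj)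
  then have "ereal L * ereal (dist u w) \<le> descending_slope E u * ereal (dist u w)"
    by (intro ereal_mult_right_mono) auto
  moreover have "L * dist u w = a - b" using \<open>u \<noteq> w\<close> by (simp add: L_def)
  ultimately show ?thesis by (simp add: a b)
qed

section \<open>From the slope inequality to the distance estimate\<close>

text \<open>The tangent line at \<open>a\<close> lies above the concave function x powr \<alpha>;
  multiplied by \<open>a powr (1 - \<alpha>)\<close>, this is Young's inequality for
  \<open>b\<close> and \<open>a\<close>. At \<open>b = 0\<close> it reduces to \<alpha> * a \<le>
  a.\<close>

lemma powr_diff_ge:
  fixes a b :: real
  assumes "0 < a" "0 \<le> b" "0 < \<alpha>" "\<alpha> \<le> 1"
  shows "\<alpha> * (a - b) \<le> a powr (1 - \<alpha>) * (a powr \<alpha> - b powr \<alpha>)"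
proof (cases "b = 0")
  case True
  have "a powr (1 - \<alpha>) * a powr \<alpha> = a"
    using assms by (simp flip: powr_add)
  then show ?thesis using True assms by (simp add: mult_left_le_one_le)
next
  case False
  have "a powr (1 - \<alpha>) * a powr \<alpha> = a"
    using assms by (simp flip: powr_add)
  moreover have "b powr \<alpha> * a powr (1 - \<alpha>) \<le> \<alpha> * b + (1 - \<alpha>) * a"
    using False assms by (intro Youngs_inequality_0) auto
  ultimately show ?thesis by (simp add: algebra_simps)
qed

lemma dist_argmin_le:
  fixes E :: "'a::complete_space \<Rightarrow> ereal"
  assumes not_minf: "\<forall>v. E v \<noteq> -\<infinity>" and lsc: "lower_semicont E"
    and \<phi>: "\<phi> \<in> dom_energy E" and minimal: "\<And>v. E \<phi> \<le> E v"
    and \<alpha>: "0 < \<alpha>" "\<alpha> \<le> 1" and "0 < c"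
    and slope: "\<And>v. v \<in> dom_energy E \<Longrightarrow>
      epowr (rel_energy E v \<phi>) (1 - \<alpha>) \<le> ereal c * descending_slope E v"
    and v: "v \<in> dom_energy E"
  shows "(INF \<psi> \<in> argmin_energy E. ereal (dist v \<psi>))
    \<le> ereal (c / \<alpha>) * epowr (rel_energy E v \<phi>) \<alpha>"
proof -
  \<comment> \<open>Since \<open>real_of_ereal\<close> sends \<infinity> to 0, \<open>f\<close> and
    \<open>g\<close> are meaningful only on \<open>dom_energy E\<close>; this is why the variational
    principle is used relative to a set.\<close>
  define f where "f u = real_of_ereal (E u) - real_of_ereal (E \<phi>)" for u
  define g where "g u = c / \<alpha> * f u powr \<alpha>" for u
  obtain e where e: "E \<phi> = ereal e"
    using \<phi> not_minf[rule_format, of \<phi>] by (cases "E \<phi>") (auto simp: dom_energy_def)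
  have E_f: "E u = ereal (e + f u)" if "u \<in> dom_energy E" for u
    using that not_minf[rule_format, of u]
    by (cases "E u") (auto simp: dom_energy_def f_def e)
  have f_nonneg: "0 \<le> f u" if "u \<in> dom_energy E" for u
    using minimal[of u] E_f[OF that] by (simp add: e)
  have rel: "rel_energy E u \<phi> = ereal (f u)" if "u \<in> dom_energy E" for u
    using E_f[OF that] by (simp add: rel_energy_def e)
  \<comment> \<open>For \<open>a \<ge> 0\<close>, inverting the increasing power turns a sublevel
    set of \<open>g\<close> into one of \<open>E\<close>; for negative \<open>a\<close> it is
    empty.\<close>
  have closed: "closed {u \<in> dom_energy E. g u \<le> a}" for a
  proof (cases "0 \<le> a")
    case True
    have sublevel: "g u \<le> a \<longleftrightarrow> f u \<le> (a * \<alpha> / c) powr (1 / \<alpha>)" if "u \<in> dom_energy E" for u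
    proof -
      have "g u \<le> a \<longleftrightarrow> f u powr \<alpha> \<le> ((a * \<alpha> / c) powr (1 / \<alpha>)) powr \<alpha>"
        using \<alpha> \<open>0 < c\<close> True by (simp add: g_def powr_powr field_simps)
      also have "\<dots> \<longleftrightarrow> f u \<le> (a * \<alpha> / c) powr (1 / \<alpha>)"
        using f_nonneg[OF that] \<alpha> by (smt (verit) powr_ge_zero powr_less_mono2 powr_mono2)
      finally show ?thesis .
    qed
    have "u \<in> dom_energy E \<and> g u \<le> a \<longleftrightarrow> E u \<le> ereal (e + (a * \<alpha> / c) powr (1 / \<alpha>))" for u
    proof (cases "u \<in> dom_energy E")
      case True
      then show ?thesis by (simp add: E_f sublevel)
    qed (simp add: dom_energy_def)
    then have "{u \<in> dom_energy E. g u \<le> a} = {u. E u \<le> ereal (e + (a * \<alpha> / c) powr (1 / \<alpha>))}"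
      by blast
    then show ?thesis using closed_sublevel_of_lower_semicont[OF lsc] by simp
  next
    case False
    moreover have "0 \<le> g u" for u using \<alpha> \<open>0 < c\<close> by (simp add: g_def)
    ultimately have "\<not> g u \<le> a" for u by (meson order_trans)
    then show ?thesis by simp
  qed
  let ?I = "INF \<psi> \<in> argmin_energy E. ereal (dist v \<psi>)"
  have approx: "?I \<le> ereal (g v / k)" if k: "0 < k" "k < 1" for k
  proof -
    have "\<exists>y \<in> dom_energy E. g y + k * dist v y \<le> g v \<and>
        (\<forall>z \<in> dom_energy E. z \<noteq> y \<longrightarrow> g y < g z + k * dist y z)"
      by (rule ekeland_variational_principle[OF closed, of 0 v k])
        (use v k \<alpha> \<open>0 < c\<close> in \<open>auto simp: g_def\<close>)
    then obtain y where y: "y \<in> dom_energy E" "g y + k * dist v y \<le> g v"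
      and y_min: "\<And>z. z \<in> dom_energy E \<Longrightarrow> z \<noteq> y \<Longrightarrow> g y < g z + k * dist y z"
      by blast
    have "f y = 0"
    proof (rule ccontr)
      assume "f y \<noteq> 0"
      then have "0 < f y" using f_nonneg[OF y(1)] by simp
      define P where "P = f y powr (1 - \<alpha>)"
      have "0 < P" using \<open>0 < f y\<close> by (simp add: P_def)
      \<comment> \<open>Here \<open>k < 1\<close> is essential: the assumption only gives slope at
        least \<open>P / c\<close>, whereas extracting a point \<open>z\<close> needs a number
        strictly below the slope.\<close>
      have "ereal (k * P / c) < descending_slope E y"
      proof (rule ccontr)
        assume "\<not> ereal (k * P / c) < descending_slope E y"
        then have "ereal c * descending_slope E y \<le> ereal c * ereal (k * P / c)"
          using \<open>0 < c\<close> by (intro ereal_mult_left_mono) auto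
        moreover have "ereal P \<le> ereal c * descending_slope E y"
          using slope[OF y(1)] by (simp add: rel[OF y(1)] epowr_def P_def)
        ultimately have "ereal P \<le> ereal c * ereal (k * P / c)" by (rule order_trans[rotated])
        then show False using \<open>0 < P\<close> \<open>0 < c\<close> k by simp
      qed
      moreover have "0 \<le> k * P / c" using \<open>0 < P\<close> \<open>0 < c\<close> k by simp
      ultimately obtain z where z: "z \<in> dom_energy E" "z \<noteq> y"
        and "k * P / c * dist z y < real_of_ereal (E y) - real_of_ereal (E z)"
        using less_descending_slopeD[OF y(1) not_minf] by metis
      then have "k * P * dist z y < c * (f y - f z)"
        using \<open>0 < c\<close> by (simp add: f_def field_simps)
      also have "\<dots> = c / \<alpha> * (\<alpha> * (f y - f z))"
        using \<alpha> by simp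
      also have "\<dots> \<le> c / \<alpha> * (P * (f y powr \<alpha> - f z powr \<alpha>))"
        unfolding P_def using powr_diff_ge[OF \<open>0 < f y\<close> f_nonneg[OF z(1)] \<alpha>] \<alpha> \<open>0 < c\<close>
        by (intro mult_left_mono) auto
      also have "\<dots> = P * (g y - g z)"
        by (simp add: g_def algebra_simps)
      finally have "P * (k * dist z y) < P * (g y - g z)"
        by (simp add: mult_ac)
      then have "k * dist z y < g y - g z"
        using \<open>0 < P\<close> by (simp only: mult_less_cancel_left_pos)
      then show False
        using y_min[OF z] by (simp add: dist_commute)
    qed
    then have "y \<in> argmin_energy E"
      using minimal E_f[OF y(1)] by (auto simp: argmin_energy_def is_arg_min_def e not_less)
    then have "?I \<le> ereal (dist v y)" by (rule INF_lower)
    also have "ereal (dist v y) \<le> ereal (g v / k)"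
    proof -
      have "k * dist v y \<le> g v"
        using y(2) \<open>f y = 0\<close> by (simp add: g_def)
      then show ?thesis
        using k by (simp add: pos_le_divide_eq mult.commute)
    qed
    finally show ?thesis .
  qed
  \<comment> \<open>The minimizer \<open>y\<close> depends on \<open>k\<close> but the infimum
    \<open>?I\<close> does not, so \<open>k\<close> can tend to 1 without any convergence of
    minimizers.\<close>
  have "((\<lambda>k. ereal (g v / k)) \<longlongrightarrow> ereal (g v / 1)) (at_left 1)"
    by (intro tendsto_intros) auto
  moreover have "\<forall>\<^sub>F k in at_left (1::real). ?I \<le> ereal (g v / k)"
    unfolding eventually_at_left_field by (intro exI[of _ 0]) (auto intro: approx)
  ultimately have "?I \<le> ereal (g v / 1)"
    by (rule tendsto_lowerbound) simp
  then show ?thesis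
    using rel[OF v] by (simp add: g_def epowr_def)
qed

section \<open>From the distance estimate to the slope inequality\<close>

text \<open>With \<open>f\<close> the energy gap and \<open>s\<close> the slope at \<open>v\<close>,
  testing \<open>diff_le\<close> against all minimizers shows that the distance to them is at least
  \<open>f / s\<close>. Comparing with the upper bound \<open>C * f powr \<alpha>\<close> and
  cancelling \<open>f powr \<alpha>\<close> gives the claim.\<close>

lemma energy_powr_le_slope:
  fixes E :: "'a::metric_space \<Rightarrow> ereal"
  assumes diff_le: "\<And>w. w \<in> dom_energy E \<Longrightarrow> E v - E w \<le> descending_slope E v * ereal (dist v w)"
    and not_minf: "\<forall>v. E v \<noteq> -\<infinity>"
    and \<phi>: "\<phi> \<in> dom_energy E" and minimal: "\<And>v. E \<phi> \<le> E v"
    and "0 < \<alpha>" and "0 < C" and v: "v \<in> dom_energy E"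
    and dist_le: "(INF \<psi> \<in> argmin_energy E. ereal (dist v \<psi>))
      \<le> ereal C * epowr (rel_energy E v \<phi>) \<alpha>"
  shows "epowr (rel_energy E v \<phi>) (1 - \<alpha>) \<le> ereal C * descending_slope E v"
proof -
  let ?I = "INF \<psi> \<in> argmin_energy E. ereal (dist v \<psi>)"
  have slope_nonneg: "0 \<le> descending_slope E v" by (auto simp: descending_slope_def)
  obtain e where e: "E \<phi> = ereal e"
    using \<phi> not_minf[rule_format, of \<phi>] by (cases "E \<phi>") (auto simp: dom_energy_def)
  obtain f where f: "E v = ereal (e + f)" "0 \<le> f"
    using v minimal[of v] e
    by (cases "E v") (auto simp: dom_energy_def intro: that[of "_ - e"])
  have rel: "rel_energy E v \<phi> = ereal f" by (simp add: rel_energy_def e f)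
  show ?thesis
  \<comment> \<open>These cases are separated to permit cancellation and division. For
    \<open>f = 0\<close> the left side is 0 even at \<alpha> = 1, because 0 powr 0 is 0; for
    infinite slope the right side is infinite.\<close>
  proof (cases "f = 0 \<or> descending_slope E v = \<infinity>")
    case True
    then show ?thesis using \<open>0 < C\<close> slope_nonneg
      by (auto simp: rel epowr_def zero_ereal_def[symmetric])
  next
    case False
    then obtain s where s: "descending_slope E v = ereal s" "0 \<le> s"
      using slope_nonneg by (cases "descending_slope E v") auto
    have "0 < f" using False f by simp
    have le: "f \<le> s * dist v \<psi>" if "\<psi> \<in> argmin_energy E" for \<psi>
    proof -
      have "E \<psi> = E \<phi>"
        using that minimal[of \<psi>] by (auto simp: argmin_energy_def is_arg_min_def not_less intro: antisym)
      then show ?thesis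
        using diff_le[of \<psi>] \<phi> by (simp add: dom_energy_def e f s)
    qed
    \<comment> \<open>Testing with the minimizer \<phi> excludes \<open>s = 0\<close>, so division
      by \<open>s\<close> is legitimate.\<close>
    have "\<phi> \<in> argmin_energy E"
      using minimal by (auto simp: argmin_energy_def is_arg_min_def not_less)
    then have "0 < s * dist v \<phi>" using le \<open>0 < f\<close> by fastforce
    then have "0 < s" using s(2) by (auto simp: zero_less_mult_iff)
    then have "ereal (f / s) \<le> ?I"
      using le by (intro INF_greatest) (simp add: field_simps)
    then have "ereal (f / s) \<le> ereal C * epowr (rel_energy E v \<phi>) \<alpha>"
      using dist_le by (rule order_trans)
    then have "f / s \<le> C * f powr \<alpha>"
      by (simp add: rel epowr_def)
    then have "f \<le> f powr \<alpha> * (C * s)"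
      using \<open>0 < s\<close> by (simp add: field_simps)
    moreover have "f powr \<alpha> * f powr (1 - \<alpha>) = f"
      using \<open>0 < f\<close> by (simp flip: powr_add)
    ultimately have "f powr (1 - \<alpha>) \<le> C * s"
      using \<open>0 < f\<close> by (metis mult_le_cancel_left_pos powr_gt_zero less_numeral_extra(3))
    then show ?thesis by (simp add: rel epowr_def s)
  qed
qed

section \<open>Minimality of \<phi> and the two implications\<close>

theorem corollary3p36:
  fixes E :: "'a::complete_space \<Rightarrow> ereal"
    and p lam \<alpha> :: real
    and \<phi> :: 'a
  assumes "1 < p" and "0 \<le> lam"
    and "length_space TYPE('a)"
    and "\<forall>v. E v \<noteq> -\<infinity>"
    and "proper_energy E"
    and "lower_semicont E"
    and "geodesically_convex lam E"
    and "\<forall>v0 \<in> dom_energy E. \<exists>v. p_gradient_flow p E v \<and> (v \<longlongrightarrow> v0) (at_right 0)"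
    and "descending_slope E \<phi> = 0"
    and "{v. rel_energy E v \<phi> > 0} \<subseteq> {v. descending_slope E v > 0}"
    and "0 < \<alpha>" and "\<alpha> \<le> 1"
  shows "(\<forall>c > 0.
      (\<forall>v \<in> dom_energy E. epowr (rel_energy E v \<phi>) (1 - \<alpha>) \<le> ereal c * descending_slope E v) \<longrightarrow>
      (\<forall>v \<in> dom_energy E. (INF \<psi> \<in> argmin_energy E. ereal (dist v \<psi>))
                            \<le> ereal (c / \<alpha>) * epowr (rel_energy E v \<phi>) \<alpha>)) \<and>
     (\<forall>c > 0.
      (\<forall>v \<in> dom_energy E. (INF \<psi> \<in> argmin_energy E. ereal (dist v \<psi>))
                            \<le> ereal (c / \<alpha>) * epowr (rel_energy E v \<phi>) \<alpha>) \<longrightarrow>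
      (\<forall>v \<in> dom_energy E. epowr (rel_energy E v \<phi>) (1 - \<alpha>)
                            \<le> ereal (c / \<alpha>) * descending_slope E v))"
proof -
  note not_minf = assms(4)
  have diff_le: "E v - E w \<le> descending_slope E v * ereal (dist v w)"
    if "v \<in> dom_energy E" "w \<in> dom_energy E" for v w
    using energy_diff_le_descending_slope[OF assms(7,2) not_minf that] .
  \<comment> \<open>The slope is infinite off the domain, so vanishing slope forces finite
    energy.\<close>
  have \<phi>: "\<phi> \<in> dom_energy E"
    using assms(9) by (auto simp: descending_slope_def split: if_splits)
  \<comment> \<open>Under convexity a point of zero slope is a global minimizer: the slope estimate
    at \<phi> has right side 0.\<close>
  have minimal: "E \<phi> \<le> E w" for w
  proof (cases "w \<in> dom_energy E")
    case True
    have "E \<phi> - E w \<le> 0"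
      using diff_le[OF \<phi> True] assms(9) by simp
    then show ?thesis
      using \<phi> not_minf[rule_format, of w]
      by (cases "E \<phi>"; cases "E w") (auto simp: dom_energy_def)
  qed (simp add: dom_energy_def)
  show ?thesis
    using dist_argmin_le[OF not_minf assms(6) \<phi> minimal assms(11,12)]
      energy_powr_le_slope[OF diff_le not_minf \<phi> minimal assms(11)] assms(11)
    by (metis (no_types, lifting) divide_pos_pos)
qed

end
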